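(* Let $A\in\mathbb{R}^{n\times n}$ be symmetric positive definite with eigenvalues $\lambda_1<\lambda_2<\dots<\lambda_n$, and let $v_1$ be a unit eigenvector for $\lambda_1$. There is a positive number $\delta$ such that for every unit vector $u_k\in\mathbb{R}^n$, setting $e_k=u_k-v_1$ and $\theta_k=u_k^\top Au_k$, if $\|e_k\|<\delta$ then $$J_k=(I-u_ku_k^\top)(A-\theta_kI)(I-u_ku_k^\top)$$ is symmetric positive definite on the subspace orthogonal to $u_k$. Moreover, $$\frac{\lambda_2-\lambda_1}{2}<z^\top J_kz<\lambda_n$$ for every unit norm vector $z$ orthogonal to $u_k$.
   Context: Norms are Euclidean. The vector $u_k$ plays the role of the $k$-th (normalized) approximation to $v_1$. *)

theory Defs
  imports "HOL-Analysis.Analysis"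
begin

definition outer_product :: "real ^ 'n \<Rightarrow> real ^ 'm \<Rightarrow> real ^ 'm ^ 'n"
  where "outer_product x y = (\<chi> i j. x $ i * y $ j)"

definition eigenvector :: "real ^ 'n ^ 'n \<Rightarrow> real ^ 'n \<Rightarrow> real \<Rightarrow> bool"
  where "eigenvector A v l \<longleftrightarrow> v \<noteq> 0 \<and> A *v v = l *\<^sub>R v"

definition eigenvalue :: "real ^ 'n ^ 'n \<Rightarrow> real \<Rightarrow> bool"
  where "eigenvalue A l \<longleftrightarrow> (\<exists>v. eigenvector A v l)"

definition symmetric_matrix :: "real ^ 'n ^ 'n \<Rightarrow> bool"
  where "symmetric_matrix A \<longleftrightarrow> transpose A = A"

definition sym_pos_def_on :: "(real ^ 'n) set \<Rightarrow> real ^ 'n ^ 'n \<Rightarrow> bool"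
  where "sym_pos_def_on S A \<longleftrightarrow>
    symmetric_matrix A \<and> (\<forall>x\<in>S. x \<noteq> 0 \<longrightarrow> 0 < x \<bullet> (A *v x))"

abbreviation sym_pos_def :: "real ^ 'n ^ 'n \<Rightarrow> bool"
  where "sym_pos_def A \<equiv> sym_pos_def_on UNIV A"

end

theory Submission
  imports Defs
begin

text \<open>
  Since the eigenvalues are distinct, unit eigenvectors \<open>w i\<close> with \<open>w 1 = v1\<close> form an orthonormal
  basis, so \<open>x \<bullet> A x\<close> is the sum of the \<open>lam i * (x \<bullet> w i)\<^sup>2\<close>. For a unit vector \<open>z\<close> orthogonal
  to \<open>u\<close> one has \<open>z \<bullet> J z = z \<bullet> A z - \<theta>\<close>. The upper bound is \<open>z \<bullet> A z \<le> lam n\<close> and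
  \<open>\<theta> > 0\<close>. For the lower bound, \<open>(z \<bullet> v1)\<^sup>2 = (z \<bullet> e)\<^sup>2 \<le> (norm e)\<^sup>2\<close> gives
  \<open>z \<bullet> A z \<ge> lam 2 - (lam 2 - lam 1) (norm e)\<^sup>2\<close>, while \<open>1 - (u \<bullet> v1)\<^sup>2 \<le> (norm e)\<^sup>2\<close> gives
  \<open>\<theta> \<le> lam 1 + (lam n - lam 1) (norm e)\<^sup>2\<close>. So
  \<open>\<delta>\<^sup>2 = (lam 2 - lam 1) / (4 (lam n - lam 1))\<close> suffices.
\<close>

lemma symmetric_matrix_inner:
  fixes A :: "real ^ 'n ^ 'n"
  assumes "symmetric_matrix A"
  shows "x \<bullet> (A *v y) = (A *v x) \<bullet> y"
  using assms by (metis dot_lmul_matrix symmetric_matrix_def transpose_matrix_vector)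

lemma eigenvectors_orthogonal:
  fixes A :: "real ^ 'n ^ 'n"
  assumes "symmetric_matrix A" "A *v x = l *\<^sub>R x" "A *v y = m *\<^sub>R y" "l \<noteq> m"
  shows "x \<bullet> y = 0"
proof -
  have "m * (x \<bullet> y) = l * (x \<bullet> y)"
    using symmetric_matrix_inner[OF assms(1), of x y] assms(2,3) by simp
  with \<open>l \<noteq> m\<close> show ?thesis by simp
qed

text \<open>Orthonormal vectors are independent, and as many of them as the dimension span the
  space.\<close>

lemma orthonormal_family_expand:
  fixes w :: "'i \<Rightarrow> 'a::euclidean_space"
  assumes fin: "finite I" and card: "card I = DIM('a)"
    and norm: "\<And>i. i \<in> I \<Longrightarrow> norm (w i) = 1"
    and orth: "\<And>i j. i \<in> I \<Longrightarrow> j \<in> I \<Longrightarrow> i \<noteq> j \<Longrightarrow> w i \<bullet> w j = 0"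
  shows "(\<Sum>i\<in>I. (x \<bullet> w i) *\<^sub>R w i) = x"
proof -
  \<comment> \<open>No repetitions occur, so the image has full cardinality and the final sum over
    it reindexes to \<open>I\<close>.\<close>
  have inj: "inj_on w I"
  proof (rule inj_onI)
    fix i j assume ij: "i \<in> I" "j \<in> I" "w i = w j"
    then have "w i \<bullet> w j = 1" using norm[of i] by (simp add: norm_eq_1)
    then show "i = j" using orth ij by fastforce
  qed
  have po: "pairwise orthogonal (w ` I)"
    by (auto simp: pairwise_def orthogonal_def) (metis orth)
  have "0 \<notin> w ` I" using norm by force
  then have "independent (w ` I)"
    using po pairwise_orthogonal_independent by blast
  moreover have "card (w ` I) = DIM('a)" using inj card by (simp add: card_image)
  ultimately have "span (w ` I) = UNIV"
    by (metis card_ge_dim_independent dim_UNIV order_refl subset_UNIV top.extremum_uniqueI)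
  then have "(\<Sum>b\<in>w ` I. (x \<bullet> b) *\<^sub>R b) = x"
    using po norm fin by (intro orthonormal_basis_expand) auto
  then show ?thesis using inj by (simp add: sum.reindex)
qed

text \<open>Diagonalization and Parseval: it suffices to expand one of the two factors of the inner
  product.\<close>

lemma eigenbasis_quadratic_form:
  fixes A :: "real ^ 'n ^ 'n"
  assumes expand: "\<And>x. (\<Sum>i\<in>I. (x \<bullet> w i) *\<^sub>R w i) = x"
    and eig: "\<And>i. i \<in> I \<Longrightarrow> A *v w i = lam i *\<^sub>R w i"
  shows "x \<bullet> (A *v x) = (\<Sum>i\<in>I. lam i * (x \<bullet> w i)\<^sup>2)"
    and "x \<bullet> x = (\<Sum>i\<in>I. (x \<bullet> w i)\<^sup>2)"
proof -
  have "A *v x = A *v (\<Sum>i\<in>I. (x \<bullet> w i) *\<^sub>R w i)" by (simp only: expand)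
  also have "\<dots> = (\<Sum>i\<in>I. (x \<bullet> w i) *\<^sub>R (lam i *\<^sub>R w i))"
    by (simp add: linear_sum[OF matrix_vector_mul_linear] matrix_vector_mult_scaleR eig)
  finally show "x \<bullet> (A *v x) = (\<Sum>i\<in>I. lam i * (x \<bullet> w i)\<^sup>2)"
    by (simp add: inner_sum_right power2_eq_square algebra_simps)
  have "x \<bullet> x = x \<bullet> (\<Sum>i\<in>I. (x \<bullet> w i) *\<^sub>R w i)" by (simp only: expand)
  then show "x \<bullet> x = (\<Sum>i\<in>I. (x \<bullet> w i)\<^sup>2)"
    by (simp add: inner_sum_right power2_eq_square)
qed

text \<open>Away from \<open>v1\<close> the eigenvalue weights lie between \<open>lam 2\<close> and
  \<open>lam CARD('n)\<close>, and the squared coefficients there add up to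
  \<open>x \<bullet> x\<close> minus that of \<open>v1\<close>.\<close>

lemma simple_spectrum_quadratic_form_bounds:
  fixes A :: "real ^ 'n ^ 'n"
  assumes n: "CARD('n) \<ge> 2"
    and sym: "symmetric_matrix A"
    and ordered: "strict_mono_on {1..CARD('n)} lam"
    and eigenvalues: "{l. eigenvalue A l} = lam ` {1..CARD('n)}"
    and v1: "eigenvector A v1 (lam 1)" "norm v1 = 1"
  shows "lam 2 * (x \<bullet> x) - (lam 2 - lam 1) * (x \<bullet> v1)\<^sup>2 \<le> x \<bullet> (A *v x)"
    and "x \<bullet> (A *v x) \<le> lam CARD('n) * (x \<bullet> x) - (lam CARD('n) - lam 1) * (x \<bullet> v1)\<^sup>2"
proof -
  let ?I = "{1..CARD('n)}"
  have "\<exists>w. norm w = 1 \<and> A *v w = lam i *\<^sub>R w" if i: "i \<in> ?I" for i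
  proof -
    have "eigenvalue A (lam i)" using eigenvalues i by blast
    then obtain v where v: "v \<noteq> 0" "A *v v = lam i *\<^sub>R v"
      unfolding eigenvalue_def eigenvector_def by blast
    then have "norm (v /\<^sub>R norm v) = 1 \<and> A *v (v /\<^sub>R norm v) = lam i *\<^sub>R (v /\<^sub>R norm v)"
      by (simp add: matrix_vector_mult_scaleR)
    then show ?thesis by blast
  qed
  then obtain w' where w': "norm (w' i) = 1 \<and> A *v w' i = lam i *\<^sub>R w' i" if "i \<in> ?I" for i
    by metis
  \<comment> \<open>The chosen vector for \<open>lam 1\<close> could be \<open>- v1\<close>; the
    override puts \<open>v1\<close> itself into the basis.\<close>
  define w where "w = w'(1 := v1)"
  have w: "norm (w i) = 1" "A *v w i = lam i *\<^sub>R w i" if "i \<in> ?I" for i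
    using w' that v1 by (auto simp: w_def eigenvector_def)
  \<comment> \<open>Distinct indices carry distinct eigenvalues, so orthogonality comes for free,
    and there are as many eigenvalues as dimensions.\<close>
  have "inj_on lam ?I" using ordered by (rule strict_mono_on_imp_inj_on)
  then have "w i \<bullet> w j = 0" if "i \<in> ?I" "j \<in> ?I" "i \<noteq> j" for i j
    using eigenvectors_orthogonal[OF sym w(2) w(2)] that by (meson inj_onD)
  then have expand: "(\<Sum>i\<in>?I. (x \<bullet> w i) *\<^sub>R w i) = x" for x
    using w(1) by (intro orthonormal_family_expand) auto
  have q: "x \<bullet> (A *v x) = (\<Sum>i\<in>?I. lam i * (x \<bullet> w i)\<^sup>2)"
    "x \<bullet> x = (\<Sum>i\<in>?I. (x \<bullet> w i)\<^sup>2)"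
    by (rule eigenbasis_quadratic_form, rule expand, erule w(2))+
  have mono: "lam i \<le> lam j" if "i \<in> ?I" "j \<in> ?I" "i \<le> j" for i j
    using strict_mono_onD[OF ordered, of i j] that by (cases "i = j") auto
  have split: "(\<Sum>i\<in>?I. f i) = f 1 + (\<Sum>i\<in>?I - {1}. f i)" for f :: "nat \<Rightarrow> real"
    using n by (intro sum.remove) auto
  have w1: "w 1 = v1" by (simp add: w_def)
  have "(\<Sum>i\<in>?I - {1}. lam 2 * (x \<bullet> w i)\<^sup>2) \<le> (\<Sum>i\<in>?I - {1}. lam i * (x \<bullet> w i)\<^sup>2)"
    using n by (intro sum_mono mult_right_mono mono) auto
  then show "lam 2 * (x \<bullet> x) - (lam 2 - lam 1) * (x \<bullet> v1)\<^sup>2 \<le> x \<bullet> (A *v x)"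
    unfolding q split w1 sum_distrib_left[symmetric] by (simp add: algebra_simps)
  have "(\<Sum>i\<in>?I - {1}. lam i * (x \<bullet> w i)\<^sup>2) \<le> (\<Sum>i\<in>?I - {1}. lam CARD('n) * (x \<bullet> w i)\<^sup>2)"
    using n by (intro sum_mono mult_right_mono mono) auto
  then show "x \<bullet> (A *v x) \<le> lam CARD('n) * (x \<bullet> x) - (lam CARD('n) - lam 1) * (x \<bullet> v1)\<^sup>2"
    unfolding q split w1 sum_distrib_left[symmetric] by (simp add: algebra_simps)
qed

lemma outer_product_mult_vector:
  fixes x :: "real ^ 'n" and y z :: "real ^ 'm"
  shows "outer_product x y *v z = (y \<bullet> z) *\<^sub>R x"
  by (simp add: vec_eq_iff matrix_vector_mult_def outer_product_def inner_vec_def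
      sum_distrib_left mult_ac)

lemma transpose_diff:
  fixes A B :: "'a::group_add ^ 'n ^ 'm"
  shows "transpose (A - B) = transpose A - transpose B"
  by (simp add: transpose_def vec_eq_iff)

lemma symmetric_matrix_deflation: "symmetric_matrix (mat 1 - outer_product u u)"
  by (simp add: symmetric_matrix_def transpose_diff)
    (simp add: transpose_def outer_product_def mult.commute)

lemma symmetric_matrix_shift:
  assumes "symmetric_matrix A"
  shows "symmetric_matrix (A - c *\<^sub>R mat 1)"
  using assms by (simp add: symmetric_matrix_def transpose_diff transpose_scalar)

lemma symmetric_matrix_congruence:
  assumes "symmetric_matrix P" "symmetric_matrix M"
  shows "symmetric_matrix (P ** M ** P)"
  using assms by (simp add: symmetric_matrix_def matrix_transpose_mul matrix_mul_assoc)

text \<open>The projector \<open>P\<close> is symmetric and fixes \<open>z\<close>, so both of its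
  copies are absorbed into \<open>z\<close>.\<close>

lemma deflated_quadratic_form:
  fixes A :: "real ^ 'n ^ 'n"
  assumes "orthogonal u z"
  defines "P \<equiv> mat 1 - outer_product u u"
  shows "z \<bullet> ((P ** (A - c *\<^sub>R mat 1) ** P) *v z) = z \<bullet> (A *v z) - c * (z \<bullet> z)"
proof -
  have Pz: "P *v z = z"
    using assms
    by (simp add: matrix_vector_mult_diff_rdistrib outer_product_mult_vector orthogonal_def)
  have "z \<bullet> ((P ** (A - c *\<^sub>R mat 1) ** P) *v z) = z \<bullet> (P *v ((A - c *\<^sub>R mat 1) *v (P *v z)))"
    by (simp add: matrix_vector_mul_assoc matrix_mul_assoc)
  also have "\<dots> = (P *v z) \<bullet> ((A - c *\<^sub>R mat 1) *v (P *v z))"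
    by (rule symmetric_matrix_inner) (simp add: P_def symmetric_matrix_deflation)
  also have "\<dots> = z \<bullet> (A *v z) - c * (z \<bullet> z)"
    by (simp add: Pz matrix_vector_mult_diff_rdistrib inner_diff_right
        flip: scaleR_matrix_vector_assoc)
  finally show ?thesis .
qed

text \<open>The quadratic form is homogeneous of degree two, so normalizing \<open>x\<close>
  preserves its sign.\<close>

lemma sym_pos_def_on_unit_vectors:
  assumes "subspace S" "symmetric_matrix M"
    and pos: "\<And>z. z \<in> S \<Longrightarrow> norm z = 1 \<Longrightarrow> 0 < z \<bullet> (M *v z)"
  shows "sym_pos_def_on S M"
  unfolding sym_pos_def_on_def
proof (intro conjI ballI impI)
  fix x assume x: "x \<in> S" "x \<noteq> 0"
  have "0 < (x /\<^sub>R norm x) \<bullet> (M *v (x /\<^sub>R norm x))"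
    using x assms(1) by (intro pos) (auto simp: subspace_scale)
  also have "\<dots> = (x \<bullet> (M *v x)) / (norm x)\<^sup>2"
    by (simp add: matrix_vector_mult_scaleR power2_eq_square divide_simps)
  finally show "0 < x \<bullet> (M *v x)"
    using x by (simp add: zero_less_divide_iff)
qed fact

theorem lemma3p1:
  fixes A :: "real ^ 'n ^ 'n"
    and lam :: "nat \<Rightarrow> real"
    and v1 :: "real ^ 'n"
  assumes n: "CARD('n) \<ge> 2"
    and spd: "sym_pos_def A"
    and ordered: "strict_mono_on {1..CARD('n)} lam"
    and eigenvalues: "{l. eigenvalue A l} = lam ` {1..CARD('n)}"
    and v1: "eigenvector A v1 (lam 1)" "norm v1 = 1"
  shows "\<exists>\<delta>>0. \<forall>u :: real ^ 'n. norm u = 1 \<longrightarrow>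
    (let e = u - v1;
         \<theta> = u \<bullet> (A *v u);
         P = mat 1 - outer_product u u;
         J = P ** (A - \<theta> *\<^sub>R mat 1) ** P
     in norm e < \<delta> \<longrightarrow>
          sym_pos_def_on {z. orthogonal u z} J \<and>
          (\<forall>z. norm z = 1 \<and> orthogonal u z \<longrightarrow>
             (lam 2 - lam 1) / 2 < z \<bullet> (J *v z) \<and> z \<bullet> (J *v z) < lam CARD('n)))"
proof -
  let ?L = "lam CARD('n)"
  have sym: "symmetric_matrix A"
    using spd by (simp add: sym_pos_def_on_def)
  note bounds = simple_spectrum_quadratic_form_bounds[OF n sym ordered eigenvalues v1]
  have l12: "lam 1 < lam 2"
    using n strict_mono_onD[OF ordered, of 1 2] by auto
  have l2n: "lam 2 \<le> ?L"
    using n strict_mono_onD[OF ordered, of 2 "CARD('n)"] by (cases "CARD('n) = 2") auto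
  \<comment> \<open>The two estimates below each lose at most \<open>K\<close>; the factor 4 keeps
    the joint loss \<open>2 * K\<close> under half of the gap \<open>lam 2 - lam 1\<close>.\<close>
  define \<delta> where "\<delta> = sqrt ((lam 2 - lam 1) / (4 * (?L - lam 1)))"
  have "\<delta> > 0" using l12 l2n by (simp add: \<delta>_def)
  have main: "(lam 2 - lam 1) / 2 < z \<bullet> (A *v z) - u \<bullet> (A *v u) \<and>
      z \<bullet> (A *v z) - u \<bullet> (A *v u) < ?L"
    if u: "norm u = 1" and e: "norm (u - v1) < \<delta>" and z: "norm z = 1" "orthogonal u z" for u z
  proof -
    define E where "E = (norm (u - v1))\<^sup>2"
    have uu: "u \<bullet> u = 1" "z \<bullet> z = 1" "v1 \<bullet> v1 = 1" using u z v1 by (simp_all add: norm_eq_1)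
    have "E < \<delta>\<^sup>2" unfolding E_def using e by (intro power_strict_mono) auto
    then have E4: "4 * ((?L - lam 1) * E) < lam 2 - lam 1"
      using l12 l2n by (simp add: \<delta>_def field_simps)
    have "z \<bullet> v1 = - (z \<bullet> (u - v1))"
      using z by (simp add: inner_diff_right orthogonal_def inner_commute)
    then have zv: "(z \<bullet> v1)\<^sup>2 \<le> E"
      using Cauchy_Schwarz_ineq[of z "u - v1"] uu by (simp add: E_def power2_norm_eq_inner)
    \<comment> \<open>With this value of \<open>E\<close>, the slack in
      \<open>1 - (u \<bullet> v1)\<^sup>2 \<le> E\<close> is a perfect square.\<close>
    have "E = 2 - 2 * (u \<bullet> v1)"
      using uu by (simp add: E_def power2_norm_eq_inner inner_diff inner_commute)
    then have "1 - (u \<bullet> v1)\<^sup>2 = E - (1 - u \<bullet> v1)\<^sup>2"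
      by (simp add: power2_eq_square algebra_simps)
    then have uv: "1 - (u \<bullet> v1)\<^sup>2 \<le> E" by simp
    \<comment> \<open>A common bound for both errors: \<open>lam 2 - lam 1\<close> is at most
      \<open>?L - lam 1\<close>.\<close>
    define K where "K = (?L - lam 1) * E"
    have "(lam 2 - lam 1) * (z \<bullet> v1)\<^sup>2 \<le> K"
      unfolding K_def using zv l12 l2n by (intro mult_mono) auto
    then have "lam 2 - K \<le> z \<bullet> (A *v z)"
      using bounds(1)[of z] uu by simp
    moreover have "(?L - lam 1) * (1 - (u \<bullet> v1)\<^sup>2) \<le> K"
      unfolding K_def using uv l12 l2n by (intro mult_left_mono) auto
    then have "u \<bullet> (A *v u) \<le> lam 1 + K"
      using bounds(2)[of u] uu by (simp add: algebra_simps)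
    moreover have "4 * K < lam 2 - lam 1"
      using E4 by (simp add: K_def)
    ultimately have "(lam 2 - lam 1) / 2 < z \<bullet> (A *v z) - u \<bullet> (A *v u)"
      by (simp add: field_simps)
    \<comment> \<open>This makes the upper bound strict, since \<open>z \<bullet> (A *v z)\<close>
      may equal \<open>?L\<close>.\<close>
    moreover have "0 < u \<bullet> (A *v u)"
      using spd u by (auto simp: sym_pos_def_on_def dest!: spec[of _ u])
    moreover have "0 \<le> (?L - lam 1) * (z \<bullet> v1)\<^sup>2"
      using l12 l2n by simp
    ultimately show ?thesis
      using bounds(2)[of z] uu by simp
  qed
  \<comment> \<open>Thus the lower bound on unit vectors also yields definiteness on the orthogonal
    complement of \<open>u\<close>.\<close>
  have half: "0 < (lam 2 - lam 1) / 2" using l12 by simp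
  show ?thesis
    unfolding Let_def
  proof (intro exI[of _ \<delta>] conjI[OF \<open>\<delta> > 0\<close>] allI impI conjI[OF sym_pos_def_on_unit_vectors])
    fix u :: "real ^ 'n"
    show "subspace {z. orthogonal u z}" by (rule subspace_orthogonal_to_vector)
  qed (use main half in \<open>force simp: deflated_quadratic_form norm_eq_1
        intro!: symmetric_matrix_congruence symmetric_matrix_deflation symmetric_matrix_shift sym\<close>)+
qed

end
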